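(* Let $\mathcal{K}$ be a compact subset of the half-plane $\{s\in\mathbb{C}:\Re(s)>1\}$. For every $d\in\mathbb{R}$ and every $\varepsilon>0$, $$\liminf_{T\to\infty}\frac{1}{T}\,\mathrm{meas}\Bigl\{\tau\in[0,T]:\ \sup_{s\in \mathcal{K}}\bigl|\zeta(s+i\tau)-\zeta(s+id\tau)\bigr|<\varepsilon\Bigr\}>0,$$ where $\zeta$ is the Riemann zeta function and $\mathrm{meas}$ is Lebesgue measure. *)

theory Defs
  imports "HOL-Analysis.Analysis"
begin

text \<open>
  The Riemann zeta function on the half-plane of absolute convergence \<open>Re s > 1\<close>, where it is
  the sum of its Dirichlet series. Only values there are meaningful: for \<open>Re s \<le> 1\<close> this is
  not the analytic continuation.
\<close>
definition zeta :: "complex \<Rightarrow> complex" where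
  "zeta s = (\<Sum>n. 1 / of_nat (Suc n) powr s)"

end

theory Submission
  imports Defs
begin

text \<open>
  Since the distance of \<open>n\<^bsup>-i\<tau>\<^esup>\<close> and \<open>n\<^bsup>-id\<tau>\<^esup>\<close> is \<open>\<bar>n\<^bsup>i(1-d)\<tau>\<^esup> - 1\<bar>\<close>, absolute convergence reduces the claim
  to the set \<open>A\<close> of those \<open>\<tau>\<close> for which finitely many unimodular numbers \<open>n\<^bsup>i(1-d)\<tau>\<^esup>\<close> are close
  to \<open>1\<close>. By the pigeonhole principle on the torus, finitely many translates of \<open>A\<close> cover the real
  line, and a set with this property has positive lower density.
\<close>

section \<open>Simultaneous recurrence of finitely many rotations\<close>

text \<open>Cut the square containing the unit circle into cells of side \<open>1/k\<close> and sort
  the times by the cells of all points \<open>cis (a i * t)\<close>. Only finitely many patterns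
  occur, and \<open>S\<close> consists of one representative time for each. Two times with the same
  pattern differ by a time at which every rotation is nearly the identity.\<close>

lemma cis_finite_translates_cover:
  fixes a :: "'i \<Rightarrow> real" and \<delta> :: real
  assumes "finite I" and "\<delta> > 0"
  obtains S :: "real set" where "finite S"
    and "\<And>t. \<exists>s\<in>S. \<forall>i\<in>I. cmod (cis (a i * (t - s)) - 1) < \<delta>"
proof -
  \<comment> \<open>Real and imaginary part each contribute an error below \<open>1/k\<close>, hence
    the \<open>2\<close>.\<close>
  obtain k :: nat where k: "k > 0" "2 / real k < \<delta>"
  proof -
    obtain k :: nat where "2 / \<delta> < real k"
      using reals_Archimedean2 by blast
    moreover from this have "k > 0"
      using \<open>\<delta> > 0\<close> by (metis divide_pos_pos less_trans of_nat_0_less_iff zero_less_numeral)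
    ultimately show ?thesis
      using that[of k] \<open>\<delta> > 0\<close> by (simp add: field_simps)
  qed
  \<comment> \<open>Restricting to \<open>I\<close> puts the codes into a finite \<open>PiE\<close>
    space.\<close>
  define code where
    "code t = (\<lambda>i\<in>I. (\<lfloor>k * cos (a i * t)\<rfloor>, \<lfloor>k * sin (a i * t)\<rfloor>))" for t
  have bounds: "\<lfloor>k * x\<rfloor> \<in> {- int k..int k}" if "\<bar>x\<bar> \<le> 1" for x :: real
  proof -
    have "\<bar>real k * x\<bar> \<le> real k"
      using that by (simp add: abs_mult mult_left_le)
    then show ?thesis
      by (simp add: floor_le_iff le_floor_iff abs_le_iff)
  qed
  have "range code \<subseteq> (I \<rightarrow>\<^sub>E {- int k..int k} \<times> {- int k..int k})"
    using bounds by (auto simp: code_def)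
  then have fin: "finite (range code)"
    by (rule finite_subset) (intro finite_PiE assms finite_cartesian_product finite_atLeastAtMost_int)
  show ?thesis
  proof (rule that[of "inv code ` range code"])
    show "finite (inv code ` range code)"
      using fin by simp
    fix t
    define s where "s = inv code (code t)"
    have same: "code s = code t"
      unfolding s_def by (simp add: f_inv_into_f)
    have close: "\<bar>x - y\<bar> < 1 / k" if "\<lfloor>k * x\<rfloor> = \<lfloor>k * y\<rfloor>" for x y :: real
    proof -
      have "\<bar>real k * x - real k * y\<bar> < 1"
        using that by linarith
      then have "real k * \<bar>x - y\<bar> < 1"
        by (metis abs_mult abs_of_nat right_diff_distrib)
      then show ?thesis
        using k(1) by (simp add: field_simps)
    qed
    have "cmod (cis (a i * (t - s)) - 1) < \<delta>" if "i \<in> I" for i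
    proof -
      have *: "\<lfloor>k * cos (a i * t)\<rfloor> = \<lfloor>k * cos (a i * s)\<rfloor>"
        "\<lfloor>k * sin (a i * t)\<rfloor> = \<lfloor>k * sin (a i * s)\<rfloor>"
        using fun_cong[OF same, of i] that by (simp_all add: code_def)
      \<comment> \<open>Rotation is an isometry, so the distance to \<open>1\<close> at time
        \<open>t - s\<close> is the distance of two points of one cell.\<close>
      have "cis (a i * t) - cis (a i * s) = cis (a i * s) * (cis (a i * (t - s)) - 1)"
        by (simp add: cis_mult algebra_simps)
      then have "cmod (cis (a i * (t - s)) - 1) = cmod (cis (a i * t) - cis (a i * s))"
        by (simp add: norm_mult)
      also have "\<dots> \<le> \<bar>cos (a i * t) - cos (a i * s)\<bar> + \<bar>sin (a i * t) - sin (a i * s)\<bar>"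
        using cmod_le[of "cis (a i * t) - cis (a i * s)"] by simp
      also have "\<dots> < 2 / k"
        using close[OF *(1)] close[OF *(2)] by simp
      finally show ?thesis
        using k(2) by linarith
    qed
    then show "\<exists>s\<in>inv code ` range code. \<forall>i\<in>I. cmod (cis (a i * (t - s)) - 1) < \<delta>"
      unfolding s_def by blast
  qed
qed

section \<open>Positive lower density\<close>

text \<open>The translates by \<open>s\<close> of the parts of \<open>A\<close> in
  \<open>{-s..T-s}\<close> cover \<open>{0..T}\<close>. Each such window leaves
  \<open>{0..T}\<close> by at most \<open>C\<close> at either end, which costs \<open>2 * C\<close>
  per translate.\<close>

lemma measure_Int_atLeastAtMost_lower_bound:
  fixes A :: "real set"
  assumes A: "A \<in> sets lebesgue" and "finite S"
    and cover: "\<And>t. \<exists>s\<in>S. t - s \<in> A"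
    and C: "\<And>s. s \<in> S \<Longrightarrow> \<bar>s\<bar> \<le> C" and "T \<ge> 0"
  shows "T \<le> real (card S) * (measure lebesgue (A \<inter> {0..T}) + 2 * C)"
proof -
  have meas: "A \<inter> {x..y} \<in> lmeasurable" for x y
    using A by (metis Int_commute fmeasurable_Int_fmeasurable lmeasurable_cbox cbox_interval)
  have "C \<ge> 0"
    using cover[of 0] C by force
  have "{0..T} \<subseteq> (\<Union>s\<in>S. (+) s ` (A \<inter> {-s..T-s}))"
  proof
    fix t assume "t \<in> {0..T}"
    moreover obtain s where "s \<in> S" "t - s \<in> A"
      using cover by blast
    ultimately show "t \<in> (\<Union>s\<in>S. (+) s ` (A \<inter> {-s..T-s}))"
      by (auto intro!: bexI[of _ s] image_eqI[of _ _ "t - s"])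
  qed
  then have "measure lebesgue {0..T} \<le> measure lebesgue (\<Union>s\<in>S. (+) s ` (A \<inter> {-s..T-s}))"
    by (intro measure_mono_fmeasurable fmeasurable.finite_UN \<open>finite S\<close> measurable_translation meas) auto
  also have "\<dots> \<le> (\<Sum>s\<in>S. measure lebesgue ((+) s ` (A \<inter> {-s..T-s})))"
    by (intro measure_UNION_le \<open>finite S\<close> fmeasurableD measurable_translation meas)
  also have "\<dots> \<le> (\<Sum>s\<in>S. measure lebesgue (A \<inter> {0..T}) + 2 * C)"
  proof (rule sum_mono)
    fix s assume "s \<in> S"
    have "measure lebesgue ((+) s ` (A \<inter> {-s..T-s})) = measure lebesgue (A \<inter> {-s..T-s})"
      by (rule measure_translation)
    also have "\<dots> \<le> measure lebesgue (A \<inter> {0..T} \<union> ({-C..0} \<union> {T..T+C}))"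
      using C[OF \<open>s \<in> S\<close>]
      by (intro measure_mono_fmeasurable fmeasurable.Un fmeasurableD meas) auto
    also have "\<dots> \<le> measure lebesgue (A \<inter> {0..T}) + measure lebesgue ({-C..0} \<union> {T..T+C})"
      by (intro measure_Un_le fmeasurableD meas) auto
    also have "measure lebesgue ({-C..0} \<union> {T..T+C}) \<le> measure lebesgue {-C..0} + measure lebesgue {T..T+C}"
      by (rule measure_Un_le) auto
    finally show "measure lebesgue ((+) s ` (A \<inter> {-s..T-s})) \<le> measure lebesgue (A \<inter> {0..T}) + 2 * C"
      using \<open>C \<ge> 0\<close> by simp
  qed
  finally show ?thesis
    using \<open>T \<ge> 0\<close> by simp
qed

lemma Liminf_density_pos_of_translates_cover:
  fixes A B :: "real set"
  assumes A: "A \<in> sets lebesgue" and "finite S"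
    and cover: "\<And>t. \<exists>s\<in>S. t - s \<in> A"
    and B: "B \<in> sets lebesgue" and "A \<subseteq> B"
  shows "Liminf at_top (\<lambda>T::real. ereal (1 / T * measure lebesgue (B \<inter> {0..T}))) > 0"
proof -
  define M where "M = real (card S)"
  have "S \<noteq> {}"
    using cover by auto
  then have "M > 0"
    using \<open>finite S\<close> by (simp add: M_def card_gt_0_iff)
  obtain C where C: "\<And>s. s \<in> S \<Longrightarrow> \<bar>s\<bar> \<le> C"
    using finite_imp_bounded[OF \<open>finite S\<close>] by (auto simp: bounded_iff)
  \<comment> \<open>Once \<open>T\<close> is at least \<open>4 * M * C\<close>, the boundary loss
    \<open>2 * M * C\<close> is at most \<open>T / 2\<close>; the remaining half of \<open>T\<close>
    yields the density \<open>1 / (2 * M)\<close>.\<close>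
  have "eventually (\<lambda>T. ereal (1 / (2 * M)) \<le> ereal (1 / T * measure lebesgue (B \<inter> {0..T}))) at_top"
    using eventually_ge_at_top[of "4 * M * C"] eventually_gt_at_top[of 0]
  proof eventually_elim
    case (elim T)
    have "T \<le> M * (measure lebesgue (A \<inter> {0..T}) + 2 * C)"
      unfolding M_def using assms C elim by (intro measure_Int_atLeastAtMost_lower_bound) auto
    also have "measure lebesgue (A \<inter> {0..T}) \<le> measure lebesgue (B \<inter> {0..T})"
    proof (rule measure_mono_fmeasurable)
      show "B \<inter> {0..T} \<in> lmeasurable"
        using B by (metis Int_commute fmeasurable_Int_fmeasurable lmeasurable_cbox cbox_interval)
    qed (use \<open>A \<subseteq> B\<close> A in auto)
    finally have "T \<le> M * measure lebesgue (B \<inter> {0..T}) + 2 * M * C"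
      using \<open>M > 0\<close> by (simp add: algebra_simps)
    with elim(1) have "T \<le> 2 * M * measure lebesgue (B \<inter> {0..T})"
      by linarith
    then show ?case
      using \<open>M > 0\<close> elim(2) by (simp add: field_simps)
  qed
  then have "ereal (1 / (2 * M)) \<le> Liminf at_top (\<lambda>T. ereal (1 / T * measure lebesgue (B \<inter> {0..T})))"
    by (rule Liminf_bounded)
  moreover have "0 < ereal (1 / (2 * M))"
    using \<open>M > 0\<close> by simp
  ultimately show ?thesis
    by order
qed

section \<open>Measurability of the set of good times\<close>

text \<open>The supremum may run over uncountably many \<open>s\<close>, but a rational fits
  strictly between it and \<open>\<epsilon>\<close>. This gives a countable union of sets that are
  closed as intersections of closed sets.\<close>

lemma sets_lebesgue_Collect_SUP_less:
  fixes h :: "'s \<Rightarrow> 'a::euclidean_space \<Rightarrow> real"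
  assumes "\<And>s. s \<in> K \<Longrightarrow> continuous_on UNIV (h s)"
  shows "{x. (SUP s\<in>K. ereal (h s x)) < ereal \<epsilon>} \<in> sets lebesgue"
proof -
  define F where "F q = (\<Inter>s\<in>K. {x. h s x \<le> real_of_rat q})" for q
  have "closed (F q)" for q
    unfolding F_def using assms by (intro closed_INT ballI closed_Collect_le continuous_on_const)
  have "{x. (SUP s\<in>K. ereal (h s x)) < ereal \<epsilon>} = (\<Union>q\<in>{q. real_of_rat q < \<epsilon>}. F q)"
  proof (intro equalityI subsetI)
    fix x assume "x \<in> {x. (SUP s\<in>K. ereal (h s x)) < ereal \<epsilon>}"
    then obtain q where q: "(SUP s\<in>K. ereal (h s x)) < ereal (real_of_rat q)" "real_of_rat q < \<epsilon>"
      using ereal_dense3 by force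
    have "h s x \<le> real_of_rat q" if "s \<in> K" for s
      using SUP_lessD[OF q(1) that] by simp
    with q(2) show "x \<in> (\<Union>q\<in>{q. real_of_rat q < \<epsilon>}. F q)"
      by (auto simp: F_def)
  next
    fix x assume "x \<in> (\<Union>q\<in>{q. real_of_rat q < \<epsilon>}. F q)"
    then obtain q where q: "real_of_rat q < \<epsilon>" "\<And>s. s \<in> K \<Longrightarrow> h s x \<le> real_of_rat q"
      by (auto simp: F_def)
    have "(SUP s\<in>K. ereal (h s x)) \<le> ereal (real_of_rat q)"
      using q(2) by (intro SUP_least) simp
    also have "\<dots> < ereal \<epsilon>"
      using q(1) by simp
    finally show "x \<in> {x. (SUP s\<in>K. ereal (h s x)) < ereal \<epsilon>}"
      by simp
  qed
  also have "\<dots> \<in> sets lebesgue"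
    using \<open>\<And>q. closed (F q)\<close> by (intro sets.countable_UN' countableI_type) auto
  finally show ?thesis .
qed

section \<open>Vertical shifts of the Dirichlet series\<close>

text \<open>This isolates the dependence on \<open>t\<close> in a unimodular factor with frequency
  \<open>ln (Suc n)\<close>.\<close>

lemma inverse_powr_vertical_shift:
  "1 / of_nat (Suc n) powr (s + \<i> * of_real t)
     = 1 / of_nat (Suc n) powr s * cis (- (ln (real (Suc n)) * t))"
proof -
  have "Ln (of_nat (Suc n)) = of_real (ln (real (Suc n)))"
    by (metis Ln_of_real of_nat_0_less_iff of_real_of_nat_eq zero_less_Suc)
  then have "of_nat (Suc n) powr (\<i> * of_real t) = cis (ln (real (Suc n)) * t)"
    by (simp add: powr_def cis_conv_exp mult_ac del: of_nat_Suc)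
  moreover have "(1::complex) / cis x = cis (- x)" for x
    by (simp add: field_simps cis_mult)
  ultimately show ?thesis
    by (simp add: powr_add field_simps del: of_nat_Suc)
qed

lemma norm_inverse_powr_le:
  assumes "\<sigma> \<le> Re s"
  shows "norm (1 / of_nat (Suc n) powr s :: complex) \<le> real (Suc n) powr - \<sigma>"
proof -
  have "norm (of_nat (Suc n) powr s :: complex) = real (Suc n) powr Re s"
    by (subst norm_powr_real_powr) auto
  moreover have "real (Suc n) powr - Re s \<le> real (Suc n) powr - \<sigma>"
    using assms by (intro powr_mono) auto
  ultimately show ?thesis
    by (simp add: norm_divide powr_minus_divide del: of_nat_Suc)
qed

lemma summable_Suc_powr_minus:
  assumes "\<sigma> > 1"
  shows "summable (\<lambda>n. real (Suc n) powr - \<sigma>)"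
  using assms by (subst summable_Suc_iff) (simp add: summable_real_powr_iff)

lemma summable_zeta:
  assumes "Re s > 1"
  shows "summable (\<lambda>n. 1 / of_nat (Suc n) powr s :: complex)"
  by (rule summable_comparison_test'[OF summable_Suc_powr_minus[OF assms]])
    (rule norm_inverse_powr_le, simp)

text \<open>The terms have a summable majorant independent of \<open>t\<close>, so the Weierstrass
  test makes the convergence uniform on the whole line. The continuity serves the measurability of
  the set of good times.\<close>

lemma continuous_on_zeta_vertical:
  assumes "Re s > 1"
  shows "continuous_on UNIV (\<lambda>t::real. zeta (s + \<i> * of_real t))"
proof -
  have "uniform_limit UNIV
      (\<lambda>N t. \<Sum>n<N. 1 / of_nat (Suc n) powr s * cis (- (ln (real (Suc n)) * t)))
      (\<lambda>t. \<Sum>n. 1 / of_nat (Suc n) powr s * cis (- (ln (real (Suc n)) * t))) sequentially"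
    by (rule Weierstrass_m_test[OF _ summable_Suc_powr_minus[OF assms]])
      (simp add: norm_mult norm_inverse_powr_le[OF order_refl]
        del: of_nat_Suc mult_1_left times_divide_eq_left)
  then have "continuous_on UNIV
      (\<lambda>t. \<Sum>n. 1 / of_nat (Suc n) powr s * cis (- (ln (real (Suc n)) * t)))"
    by (rule uniform_limit_theorem[rotated])
      (auto intro!: always_eventually continuous_intros simp del: of_nat_Suc)
  then show ?thesis
    unfolding zeta_def inverse_powr_vertical_shift .
qed

text \<open>The first \<open>N\<close> terms are controlled by \<open>close\<close>, the tail by the
  trivial bound \<open>2\<close> for the distance of two unimodular numbers.\<close>

lemma norm_zeta_shift_diff_le:
  assumes \<sigma>: "\<sigma> > 1" "\<sigma> \<le> Re s" and "\<delta> \<ge> 0"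
    and close: "\<And>n. n < N \<Longrightarrow> cmod (cis (ln (real (Suc n)) * (t - u)) - 1) \<le> \<delta>"
  shows "cmod (zeta (s + \<i> * of_real t) - zeta (s + \<i> * of_real u))
    \<le> \<delta> * (\<Sum>n. real (Suc n) powr - \<sigma>) + 2 * (\<Sum>n. real (Suc (n + N)) powr - \<sigma>)"
proof -
  define b where "b n = real (Suc n) powr - \<sigma>" for n
  define c where "c n = 1 / of_nat (Suc n) powr (s + \<i> * of_real t)
    - 1 / of_nat (Suc n) powr (s + \<i> * of_real u)" for n :: nat
  have b: "summable b" "\<And>n. b n \<ge> 0"
    using summable_Suc_powr_minus[OF \<sigma>(1)] by (simp_all add: b_def[abs_def])
  have c_sums: "c sums (zeta (s + \<i> * of_real t) - zeta (s + \<i> * of_real u))"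
    unfolding zeta_def c_def using \<sigma> by (intro sums_diff summable_sums summable_zeta) auto
  have norm_c: "norm (c n) \<le> b n * cmod (cis (ln (real (Suc n)) * (t - u)) - 1)" for n
  proof -
    define l where "l = ln (real (Suc n))"
    \<comment> \<open>Factoring out a unimodular number leaves a quantity that depends on
      \<open>t - u\<close> alone.\<close>
    have "cis (- (l * t)) - cis (- (l * u)) = - cis (- (l * t)) * (cis (l * (t - u)) - 1)"
      by (simp add: cis_mult algebra_simps)
    then have "c n = 1 / of_nat (Suc n) powr s * (- cis (- (l * t)) * (cis (l * (t - u)) - 1))"
      unfolding c_def inverse_powr_vertical_shift l_def right_diff_distrib[symmetric] by simp
    then have "norm (c n) = norm (1 / of_nat (Suc n) powr s :: complex) * cmod (cis (l * (t - u)) - 1)"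
      by (simp only: norm_mult norm_minus_cancel norm_cis mult_1_left)
    then show ?thesis
      unfolding l_def b_def using norm_inverse_powr_le[OF \<sigma>(2), of n]
      by (simp add: mult_right_mono del: of_nat_Suc)
  qed
  have c2: "norm (c n) \<le> 2 * b n" for n
  proof -
    have "cmod (cis x - 1) \<le> 2" for x
      using norm_triangle_ineq4[of "cis x" 1] by simp
    then show ?thesis
      using norm_c[of n] mult_left_mono[OF _ b(2)[of n]] by (metis mult.commute order_trans)
  qed
  have sc: "summable (\<lambda>n. norm (c n))"
    by (rule summable_comparison_test'[OF summable_mult[OF b(1), of 2]]) (use c2 in simp)
  have "cmod (zeta (s + \<i> * of_real t) - zeta (s + \<i> * of_real u)) \<le> (\<Sum>n. norm (c n))"
    using summable_norm[OF sc] sums_unique[OF c_sums] by simp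
  also have "\<dots> = (\<Sum>n<N. norm (c n)) + (\<Sum>n. norm (c (n + N)))"
    using suminf_split_initial_segment[OF sc, of N] by simp
  also have "(\<Sum>n<N. norm (c n)) \<le> (\<Sum>n<N. \<delta> * b n)"
  proof (rule sum_mono)
    fix n assume "n \<in> {..<N}"
    then show "norm (c n) \<le> \<delta> * b n"
      using norm_c[of n] mult_left_mono[OF close b(2)[of n], of n] by (simp add: mult.commute)
  qed
  also have "\<dots> \<le> \<delta> * suminf b"
    unfolding sum_distrib_left[symmetric]
    using b \<open>\<delta> \<ge> 0\<close> by (intro mult_left_mono sum_le_suminf) auto
  also have "(\<Sum>n. norm (c (n + N))) \<le> (\<Sum>n. 2 * b (n + N))"
    using c2 sc b by (intro suminf_le summable_ignore_initial_segment summable_mult) auto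
  also have "\<dots> = 2 * (\<Sum>n. b (n + N))"
    using b by (intro suminf_mult summable_ignore_initial_segment)
  finally show ?thesis
    unfolding b_def by simp
qed

text \<open>Compactness keeps \<open>K\<close> in a half-plane \<open>Re s \<ge> \<sigma>\<close>
  with \<open>\<sigma> > 1\<close>; \<open>N\<close> and \<open>\<delta>\<close> are then chosen
  from \<open>\<sigma>\<close> and \<open>\<epsilon>\<close>, uniformly in \<open>s\<close>.\<close>

lemma zeta_shift_uniformly_close:
  assumes "compact K" and "K \<subseteq> {s. Re s > 1}" and "\<epsilon> > 0"
  obtains N :: nat and \<delta> :: real where "\<delta> > 0"
    and "\<And>s t u. s \<in> K \<Longrightarrow> \<forall>n<N. cmod (cis (ln (real (Suc n)) * (t - u)) - 1) < \<delta> \<Longrightarrow>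
      cmod (zeta (s + \<i> * of_real t) - zeta (s + \<i> * of_real u)) \<le> \<epsilon>"
proof -
  \<comment> \<open>The minimum of \<open>Re\<close> on \<open>K\<close> serves as
    \<open>\<sigma>\<close>; for empty \<open>K\<close> there is no minimum and \<open>2\<close> is
    an arbitrary choice.\<close>
  obtain \<sigma> where \<sigma>: "\<sigma> > 1" "\<And>s. s \<in> K \<Longrightarrow> \<sigma> \<le> Re s"
  proof (cases "K = {}")
    case True
    then show ?thesis using that[of 2] by simp
  next
    case False
    then obtain s0 where "s0 \<in> K" "\<And>s. s \<in> K \<Longrightarrow> Re s0 \<le> Re s"
      using continuous_attains_inf[OF \<open>compact K\<close> _ continuous_on_Re[OF continuous_on_id]] by auto
    then show ?thesis using that assms(2) by blast
  qed
  define b where "b n = real (Suc n) powr - \<sigma>" for n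
  have b: "summable b" "\<And>n. b n \<ge> 0"
    using summable_Suc_powr_minus[OF \<sigma>(1)] by (simp_all add: b_def[abs_def])
  have Z: "suminf b \<ge> 0"
    using b by (intro suminf_nonneg) auto
  \<comment> \<open>The tail enters the estimate with factor \<open>2\<close>, so it contributes
    less than \<open>\<epsilon> / 2\<close>.\<close>
  obtain N where N: "norm (\<Sum>n. b (n + N)) < \<epsilon> / 4"
    using suminf_exist_split[OF _ b(1), of "\<epsilon> / 4"] \<open>\<epsilon> > 0\<close> by auto
  \<comment> \<open>This makes the head contribute at most \<open>\<epsilon> / 2\<close>; the
    \<open>+ 1\<close> keeps the denominator visibly positive.\<close>
  define \<delta> where "\<delta> = \<epsilon> / (2 * (suminf b + 1))"
  have "\<delta> > 0"
    using Z \<open>\<epsilon> > 0\<close> by (simp add: \<delta>_def)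
  have "\<delta> * suminf b \<le> \<epsilon> / 2"
    using Z \<open>\<epsilon> > 0\<close> by (simp add: \<delta>_def field_simps)
  show ?thesis
  proof (rule that[OF \<open>\<delta> > 0\<close>, of N])
    fix s t u
    assume "s \<in> K" and close: "\<forall>n<N. cmod (cis (ln (real (Suc n)) * (t - u)) - 1) < \<delta>"
    have "cmod (zeta (s + \<i> * of_real t) - zeta (s + \<i> * of_real u))
        \<le> \<delta> * suminf b + 2 * (\<Sum>n. b (n + N))"
      unfolding b_def using \<sigma> \<open>s \<in> K\<close> \<open>\<delta> > 0\<close> close
      by (intro norm_zeta_shift_diff_le) (auto simp: less_imp_le)
    also have "\<dots> \<le> \<epsilon>"
      using N \<open>\<delta> * suminf b \<le> \<epsilon> / 2\<close> by simp
    finally show "cmod (zeta (s + \<i> * of_real t) - zeta (s + \<i> * of_real u)) \<le> \<epsilon>" .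
  qed
qed

section \<open>Self-approximation of zeta along two speeds\<close>

theorem theorem4p1:
  fixes K :: "complex set" and d \<epsilon> :: real
  assumes "compact K"
    and "K \<subseteq> {s. Re s > 1}"
    and "\<epsilon> > 0"
  shows "Liminf at_top
           (\<lambda>T::real. ereal (1 / T * measure lebesgue
              {\<tau> \<in> {0..T}.
                 (SUP s\<in>K. ereal (cmod (zeta (s + \<i> * of_real \<tau>)
                                     - zeta (s + \<i> * of_real d * of_real \<tau>)))) < ereal \<epsilon>}))
         > 0"
proof -
  define h where
    "h s \<tau> = cmod (zeta (s + \<i> * of_real \<tau>) - zeta (s + \<i> * of_real d * of_real \<tau>))" for s \<tau>
  define B where "B = {\<tau>. (SUP s\<in>K. ereal (h s \<tau>)) < ereal \<epsilon>}"
  \<comment> \<open>Pointwise bounds give only a non-strict bound for the supremum; aiming at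
    \<open>\<epsilon> / 2\<close> leaves room for the strict inequality.\<close>
  have "\<epsilon> / 2 > 0"
    using assms(3) by simp
  from zeta_shift_uniformly_close[OF assms(1,2) this]
  obtain N \<delta> where "\<delta> > 0" and
    close: "\<And>s t u. s \<in> K \<Longrightarrow> \<forall>n<N. cmod (cis (ln (real (Suc n)) * (t - u)) - 1) < \<delta> \<Longrightarrow>
      cmod (zeta (s + \<i> * of_real t) - zeta (s + \<i> * of_real u)) \<le> \<epsilon> / 2"
    by metis
  \<comment> \<open>With \<open>t = \<tau>\<close> and \<open>u = d * \<tau>\<close> the difference
    \<open>t - u\<close> is \<open>(1 - d) * \<tau>\<close>.\<close>
  define a where "a n = ln (real (Suc n)) * (1 - d)" for n
  define A where "A = (\<Inter>n\<in>{..<N}. {\<tau>. cmod (cis (a n * \<tau>) - 1) < \<delta>})"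
  obtain S where S: "finite S"
    "\<And>t. \<exists>s\<in>S. \<forall>n\<in>{..<N}. cmod (cis (a n * (t - s)) - 1) < \<delta>"
    using cis_finite_translates_cover[OF finite_lessThan \<open>\<delta> > 0\<close>] by metis
  have "open A"
    unfolding A_def by (intro open_INT ballI open_Collect_less continuous_intros) auto
  then have "A \<in> sets lebesgue"
    by auto
  moreover have "\<exists>s\<in>S. t - s \<in> A" for t
    using S(2)[of t] by (auto simp: A_def)
  moreover have "B \<in> sets lebesgue"
    unfolding B_def
  proof (rule sets_lebesgue_Collect_SUP_less)
    fix s assume "s \<in> K"
    then have cont: "continuous_on UNIV (\<lambda>t::real. zeta (s + \<i> * of_real t))"
      using assms(2) by (intro continuous_on_zeta_vertical) auto
    \<comment> \<open>The second zeta term is the same vertical function, run at speed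
      \<open>d\<close>.\<close>
    have "continuous_on UNIV (\<lambda>\<tau>. zeta (s + \<i> * of_real (d * \<tau>)))"
      by (rule continuous_on_compose2[OF cont]) (auto intro!: continuous_intros)
    with cont show "continuous_on UNIV (h s)"
      unfolding h_def by (intro continuous_intros) (simp_all add: mult_ac)
  qed
  moreover have "A \<subseteq> B"
  proof
    fix \<tau> assume "\<tau> \<in> A"
    have "h s \<tau> \<le> \<epsilon> / 2" if "s \<in> K" for s
      using close[OF that, of \<tau> "d * \<tau>"] \<open>\<tau> \<in> A\<close>
      by (auto simp: h_def A_def a_def algebra_simps)
    then have "(SUP s\<in>K. ereal (h s \<tau>)) \<le> ereal (\<epsilon> / 2)"
      by (intro SUP_least) simp
    also have "\<dots> < ereal \<epsilon>"
      using assms(3) by simp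
    finally show "\<tau> \<in> B"
      by (simp add: B_def)
  qed
  ultimately have "Liminf at_top (\<lambda>T::real. ereal (1 / T * measure lebesgue (B \<inter> {0..T}))) > 0"
    using S(1) by (intro Liminf_density_pos_of_translates_cover)
  moreover have "B \<inter> {0..T} = {\<tau> \<in> {0..T}. (SUP s\<in>K. ereal (h s \<tau>)) < ereal \<epsilon>}" for T
    by (auto simp: B_def)
  ultimately show ?thesis
    unfolding h_def by simp
qed

end
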